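(* Every locally compact Hausdorff topology $\tau$ on the semigroup $\mathscr{I}_{\infty}^{\nearrow}(\mathbb{N})$ such that $(\mathscr{I}_{\infty}^{\nearrow}(\mathbb{N}),\tau)$ is a topological inverse semigroup is discrete.
   Context: $\mathbb{N}$ is the set of positive integers. $\mathscr{I}_{\infty}^{\nearrow}(\mathbb{N})$ is the set of all injective, order-preserving (hence strictly increasing) partial maps $\varphi\colon\mathbb{N}\rightharpoonup\mathbb{N}$ such that $\mathbb{N}\setminus\operatorname{dom}\varphi$ and $\mathbb{N}\setminus\operatorname{ran}\varphi$ are finite, where $\operatorname{ran}\varphi$ is the image of $\varphi$. The operation is composition of partial maps written on the right: $x(\alpha\beta)=(x\alpha)\beta$, with $\operatorname{dom}(\alpha\beta)=\{y\in\operatorname{dom}\alpha\mid y\alpha\in\operatorname{dom}\beta\}$. This is an inverse semigroup; the inverse $\alpha^{-1}$ is the inverse partial map. A topological inverse semigroup is an inverse semigroup with a topology for which the multiplication $S\times S\to S$ is (jointly) continuous and the inversion $x\mapsto x^{-1}$ is continuous. *)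

theory Defs
  imports "HOL-Analysis.Analysis"
begin

text \<open>
  Partial maps on the positive integers are rendered as \<^typ>\<open>nat \<rightharpoonup> nat\<close> whose domain and range
  avoid \<open>0\<close>. Maps are written on the right, so the product \<open>\<alpha>\<beta>\<close> (first \<open>\<alpha>\<close>, then \<open>\<beta>\<close>) is
  \<^term>\<open>\<beta> \<circ>\<^sub>m \<alpha>\<close>.
\<close>

definition pos_nats :: "nat set" where
  "pos_nats = {n. 0 < n}"

definition cofinite_monotone_pmaps :: "(nat \<rightharpoonup> nat) set" where
  "cofinite_monotone_pmaps =
     {\<phi>. dom \<phi> \<subseteq> pos_nats \<and> ran \<phi> \<subseteq> pos_nats \<and>
         inj_on \<phi> (dom \<phi>) \<and> mono_on (dom \<phi>) (\<lambda>x. the (\<phi> x)) \<and>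
         finite (pos_nats - dom \<phi>) \<and> finite (pos_nats - ran \<phi>)}"

definition pmap_mult :: "('a \<rightharpoonup> 'a) \<Rightarrow> ('a \<rightharpoonup> 'a) \<Rightarrow> ('a \<rightharpoonup> 'a)" where
  "pmap_mult \<alpha> \<beta> = \<beta> \<circ>\<^sub>m \<alpha>"

text \<open>The inverse partial map; meaningful for injective partial maps only.\<close>

definition pmap_inv :: "('a \<rightharpoonup> 'b) \<Rightarrow> ('b \<rightharpoonup> 'a)" where
  "pmap_inv \<alpha> = (\<lambda>y. if y \<in> ran \<alpha> then Some (THE x. \<alpha> x = Some y) else None)"

definition inverse_semigroup ::
    "'a set \<Rightarrow> ('a \<Rightarrow> 'a \<Rightarrow> 'a) \<Rightarrow> ('a \<Rightarrow> 'a) \<Rightarrow> bool" where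
  "inverse_semigroup S mul iv \<longleftrightarrow>
     (\<forall>x\<in>S. \<forall>y\<in>S. mul x y \<in> S) \<and>
     (\<forall>x\<in>S. \<forall>y\<in>S. \<forall>z\<in>S. mul (mul x y) z = mul x (mul y z)) \<and>
     (\<forall>x\<in>S. iv x \<in> S \<and>
        (\<forall>y\<in>S. mul (mul x y) x = x \<and> mul (mul y x) y = y \<longleftrightarrow> y = iv x))"

definition topological_inverse_semigroup ::
    "'a topology \<Rightarrow> ('a \<Rightarrow> 'a \<Rightarrow> 'a) \<Rightarrow> ('a \<Rightarrow> 'a) \<Rightarrow> bool" where
  "topological_inverse_semigroup T mul iv \<longleftrightarrow>
     inverse_semigroup (topspace T) mul iv \<and>
     continuous_map (prod_topology T T) T (\<lambda>(x, y). mul x y) \<and>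
     continuous_map T T iv"

lemma pmap_mult_eq_Some:
  "pmap_mult \<alpha> \<beta> x = Some z \<longleftrightarrow> (\<exists>y. \<alpha> x = Some y \<and> \<beta> y = Some z)"
  by (simp add: pmap_mult_def map_comp_Some_iff)

lemma dom_pmap_mult:
  "dom (pmap_mult \<alpha> \<beta>) = {y \<in> dom \<alpha>. the (\<alpha> y) \<in> dom \<beta>}"
  by (auto simp: dom_def pmap_mult_eq_Some)

lemma pmap_mult_assoc:
  "pmap_mult (pmap_mult \<alpha> \<beta>) \<gamma> = pmap_mult \<alpha> (pmap_mult \<beta> \<gamma>)"
  by (auto simp: pmap_mult_def map_comp_def fun_eq_iff split: option.splits)

lemma pmap_inv_eq_Some:
  assumes "inj_on \<alpha> (dom \<alpha>)"
  shows "pmap_inv \<alpha> y = Some x \<longleftrightarrow> \<alpha> x = Some y"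
proof -
  have uniq: "x' = x''" if "\<alpha> x' = Some y" "\<alpha> x'' = Some y" for x' x''
    using that inj_onD[OF assms, of x' x''] by auto
  show ?thesis
  proof (cases "y \<in> ran \<alpha>")
    case True
    then obtain w where w: "\<alpha> w = Some y" by (auto simp: ran_def)
    then have "(THE x. \<alpha> x = Some y) = w" by (blast intro: uniq)
    then show ?thesis using True w uniq by (auto simp: pmap_inv_def)
  next
    case False
    then show ?thesis by (auto simp: pmap_inv_def ran_def)
  qed
qed

lemma cofinite_monotone_pmaps_iff:
  "\<phi> \<in> cofinite_monotone_pmaps \<longleftrightarrow>
     (\<forall>x y. \<phi> x = Some y \<longrightarrow> 0 < x \<and> 0 < y) \<and>
     (\<forall>x x' y y'. \<phi> x = Some y \<longrightarrow> \<phi> x' = Some y' \<longrightarrow> x < x' \<longleftrightarrow> y < y') \<and>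
     finite (pos_nats - dom \<phi>) \<and> finite (pos_nats - ran \<phi>)"
  (is "?L \<longleftrightarrow> ?pos \<and> ?mono \<and> ?fin")
proof
  assume L: ?L
  then have inj: "inj_on \<phi> (dom \<phi>)" and mono: "mono_on (dom \<phi>) (\<lambda>x. the (\<phi> x))"
    by (auto simp: cofinite_monotone_pmaps_def)
  have le: "y \<le> y'" if "\<phi> x = Some y" "\<phi> x' = Some y'" "x \<le> x'" for x x' y y'
    using mono_onD[OF mono, of x x'] that by (simp add: domI)
  have ne: "y \<noteq> y'" if "\<phi> x = Some y" "\<phi> x' = Some y'" "x \<noteq> x'" for x x' y y'
    using inj_onD[OF inj, of x x'] that by auto
  have ?mono
  proof (intro allI impI)
    fix x x' y y' assume *: "\<phi> x = Some y" "\<phi> x' = Some y'"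
    show "x < x' \<longleftrightarrow> y < y'"
      using le[OF *] le[OF *(2) *(1)] ne[OF *] * by fastforce
  qed
  moreover have ?pos
    using L by (auto simp: cofinite_monotone_pmaps_def pos_nats_def dom_def ran_def)
  ultimately show "?pos \<and> ?mono \<and> ?fin"
    using L by (auto simp: cofinite_monotone_pmaps_def)
next
  assume R: "?pos \<and> ?mono \<and> ?fin"
  have "inj_on \<phi> (dom \<phi>)"
  proof (rule inj_onI)
    fix x x' assume "x \<in> dom \<phi>" "x' \<in> dom \<phi>" "\<phi> x = \<phi> x'"
    then obtain y where "\<phi> x = Some y" "\<phi> x' = Some y" by auto
    then have "\<not> x < x'" "\<not> x' < x" using R by blast+
    then show "x = x'" by simp
  qed
  moreover have "mono_on (dom \<phi>) (\<lambda>x. the (\<phi> x))"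
  proof (rule mono_onI)
    fix x x' assume "x \<in> dom \<phi>" "x' \<in> dom \<phi>" and le: "x \<le> x'"
    then obtain y y' where "\<phi> x = Some y" "\<phi> x' = Some y'" by auto
    moreover from this have "\<not> y' < y" using R le leD by blast
    ultimately show "the (\<phi> x) \<le> the (\<phi> x')" by simp
  qed
  ultimately show ?L
    using R by (auto simp: cofinite_monotone_pmaps_def pos_nats_def ran_def)
qed

lemma cofinite_monotone_pmaps_inj_on:
  "\<phi> \<in> cofinite_monotone_pmaps \<Longrightarrow> inj_on \<phi> (dom \<phi>)"
  by (simp add: cofinite_monotone_pmaps_def)

lemma pmap_mult_closed:
  assumes \<alpha>: "\<alpha> \<in> cofinite_monotone_pmaps" and \<beta>: "\<beta> \<in> cofinite_monotone_pmaps"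
  shows "pmap_mult \<alpha> \<beta> \<in> cofinite_monotone_pmaps"
proof -
  let ?p = "pmap_mult \<alpha> \<beta>"
  have pos: "\<forall>x y. ?p x = Some y \<longrightarrow> 0 < x \<and> 0 < y"
    using \<alpha> \<beta> unfolding cofinite_monotone_pmaps_iff pmap_mult_eq_Some by blast
  have mono: "\<forall>x x' y y'. ?p x = Some y \<longrightarrow> ?p x' = Some y' \<longrightarrow> x < x' \<longleftrightarrow> y < y'"
  proof (intro allI impI)
    fix x x' z z' assume "?p x = Some z" "?p x' = Some z'"
    then obtain y y' where y: "\<alpha> x = Some y" "\<beta> y = Some z" "\<alpha> x' = Some y'" "\<beta> y' = Some z'"
      by (auto simp: pmap_mult_eq_Some)
    have "x < x' \<longleftrightarrow> y < y'"
      using \<alpha> y(1,3) unfolding cofinite_monotone_pmaps_iff by blast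
    also have "\<dots> \<longleftrightarrow> z < z'"
      using \<beta> y(2,4) unfolding cofinite_monotone_pmaps_iff by blast
    finally show "x < x' \<longleftrightarrow> z < z'" .
  qed
  have "pos_nats - dom ?p \<subseteq>
      (pos_nats - dom \<alpha>) \<union> (\<lambda>y. the (pmap_inv \<alpha> y)) ` (pos_nats - dom \<beta>)"
  proof
    fix x assume x: "x \<in> pos_nats - dom ?p"
    show "x \<in> (pos_nats - dom \<alpha>) \<union> (\<lambda>y. the (pmap_inv \<alpha> y)) ` (pos_nats - dom \<beta>)"
    proof (cases "\<alpha> x")
      case None
      then show ?thesis using x by auto
    next
      case (Some y)
      have "pmap_inv \<alpha> y = Some x"
        using Some pmap_inv_eq_Some[OF cofinite_monotone_pmaps_inj_on[OF \<alpha>]] by simp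
      moreover have "y \<in> pos_nats"
        using Some \<alpha> by (auto simp: cofinite_monotone_pmaps_iff pos_nats_def)
      moreover have "y \<notin> dom \<beta>"
        using x Some by (auto simp: dom_pmap_mult)
      ultimately show ?thesis by (force simp: image_iff)
    qed
  qed
  then have fin1: "finite (pos_nats - dom ?p)"
    by (rule finite_subset) (use \<alpha> \<beta> in \<open>simp add: cofinite_monotone_pmaps_iff\<close>)
  have "pos_nats - ran ?p \<subseteq>
      (pos_nats - ran \<beta>) \<union> (\<lambda>y. the (\<beta> y)) ` (pos_nats - ran \<alpha>)"
  proof
    fix z assume z: "z \<in> pos_nats - ran ?p"
    show "z \<in> (pos_nats - ran \<beta>) \<union> (\<lambda>y. the (\<beta> y)) ` (pos_nats - ran \<alpha>)"
    proof (cases "z \<in> ran \<beta>")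
      case False
      then show ?thesis using z by auto
    next
      case True
      then obtain y where y: "\<beta> y = Some z" by (auto simp: ran_def)
      then have "y \<in> pos_nats"
        using \<beta> by (auto simp: cofinite_monotone_pmaps_iff pos_nats_def)
      moreover have "y \<notin> ran \<alpha>"
        using z y by (auto simp: ran_def pmap_mult_eq_Some)
      ultimately show ?thesis using y by (force simp: image_iff)
    qed
  qed
  then have fin2: "finite (pos_nats - ran ?p)"
    by (rule finite_subset) (use \<alpha> \<beta> in \<open>simp add: cofinite_monotone_pmaps_iff\<close>)
  show ?thesis
    using pos mono fin1 fin2 unfolding cofinite_monotone_pmaps_iff by blast
qed

lemma pmap_inv_closed:
  assumes "\<alpha> \<in> cofinite_monotone_pmaps"
  shows "pmap_inv \<alpha> \<in> cofinite_monotone_pmaps"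
proof -
  note inv = pmap_inv_eq_Some[OF cofinite_monotone_pmaps_inj_on[OF assms]]
  have "dom (pmap_inv \<alpha>) = ran \<alpha>" "ran (pmap_inv \<alpha>) = dom \<alpha>"
    by (auto simp: dom_def ran_def inv)
  then show ?thesis
    using assms by (simp add: cofinite_monotone_pmaps_iff inv)
qed

lemma pmap_inverse_iff:
  assumes \<alpha>: "inj_on \<alpha> (dom \<alpha>)" and \<beta>: "inj_on \<beta> (dom \<beta>)"
  shows "pmap_mult (pmap_mult \<alpha> \<beta>) \<alpha> = \<alpha> \<and> pmap_mult (pmap_mult \<beta> \<alpha>) \<beta> = \<beta> \<longleftrightarrow>
    \<beta> = pmap_inv \<alpha>"
proof -
  have eq: "f = g \<longleftrightarrow> (\<forall>x y. f x = Some y \<longleftrightarrow> g x = Some y)" for f g :: "'a \<rightharpoonup> 'a"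
  proof
    assume "\<forall>x y. f x = Some y \<longleftrightarrow> g x = Some y"
    then show "f = g" by (metis ext not_Some_eq)
  qed simp
  have inj\<alpha>: "x = x'" if "\<alpha> x = Some y" "\<alpha> x' = Some y" for x x' y
    using inj_onD[OF \<alpha>, of x x'] that by auto
  have inj\<beta>: "x = x'" if "\<beta> x = Some y" "\<beta> x' = Some y" for x x' y
    using inj_onD[OF \<beta>, of x x'] that by auto
  show ?thesis
  proof
    assume L: "pmap_mult (pmap_mult \<alpha> \<beta>) \<alpha> = \<alpha> \<and> pmap_mult (pmap_mult \<beta> \<alpha>) \<beta> = \<beta>"
    have "\<beta> y = Some x" if xy: "\<alpha> x = Some y" for x y
    proof -
      have "pmap_mult (pmap_mult \<alpha> \<beta>) \<alpha> x = Some y" using L xy by simp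
      then obtain z where "\<beta> y = Some z" "\<alpha> z = Some y"
        using xy by (auto simp: pmap_mult_eq_Some)
      then show ?thesis using inj\<alpha>[OF _ xy] by blast
    qed
    moreover have "\<alpha> x = Some y" if yx: "\<beta> y = Some x" for x y
    proof -
      have "pmap_mult (pmap_mult \<beta> \<alpha>) \<beta> y = Some x" using L yx by simp
      then obtain w where "\<alpha> x = Some w" "\<beta> w = Some x"
        using yx by (auto simp: pmap_mult_eq_Some)
      then show ?thesis using inj\<beta>[OF _ yx] by blast
    qed
    ultimately show "\<beta> = pmap_inv \<alpha>"
      unfolding eq pmap_inv_eq_Some[OF \<alpha>] by blast
  next
    assume "\<beta> = pmap_inv \<alpha>"
    then have \<beta>_iff: "\<beta> y = Some x \<longleftrightarrow> \<alpha> x = Some y" for x y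
      using pmap_inv_eq_Some[OF \<alpha>] by simp
    show "pmap_mult (pmap_mult \<alpha> \<beta>) \<alpha> = \<alpha> \<and> pmap_mult (pmap_mult \<beta> \<alpha>) \<beta> = \<beta>"
      unfolding eq pmap_mult_eq_Some \<beta>_iff by (auto dest: inj\<alpha>)
  qed
qed

lemma inverse_semigroup_cofinite_monotone_pmaps:
  "inverse_semigroup cofinite_monotone_pmaps pmap_mult pmap_inv"
  unfolding inverse_semigroup_def
proof (intro conjI ballI)
  fix x y assume "x \<in> cofinite_monotone_pmaps" "y \<in> cofinite_monotone_pmaps"
  then show "(pmap_mult (pmap_mult x y) x = x \<and> pmap_mult (pmap_mult y x) y = y) = (y = pmap_inv x)"
    by (intro pmap_inverse_iff cofinite_monotone_pmaps_inj_on)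
qed (simp_all only: pmap_mult_closed pmap_mult_assoc pmap_inv_closed)

end

theory Submission
  imports Defs
begin

text \<open>
  The semigroup is countable, because an element is determined by its domain and its range, both
  cofinite (\<open>cofinite_monotone_pmaps_eqI\<close>). A countable locally compact Hausdorff
  space is a countable union of closed singletons, so by the Baire category theorem one of these
  singletons has nonempty interior: there is an isolated point \<open>\<alpha>\<close>.

  Isolatedness then spreads from \<open>\<alpha>\<close> to an arbitrary element \<open>\<xi>\<close>. Any two cofinite sets of positive
  integers are the domain and the range of some element of the semigroup, so \<open>\<beta>\<xi>\<gamma> = \<alpha>\<close> where
  \<open>\<beta>\<close> maps \<open>dom \<alpha>\<close> onto \<open>dom \<xi>\<close> and \<open>\<gamma>\<close> maps \<open>ran \<xi>\<close> onto \<open>ran \<alpha>\<close>. The set of all solutions \<open>\<eta>\<close> of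
  \<open>\<beta>\<eta>\<gamma> = \<alpha>\<close> is open, being the preimage of an open singleton under a continuous map. It is also finite:
  a solution must be defined on all of \<open>dom \<xi>\<close> and attain all of \<open>ran \<xi>\<close>, which leaves only finitely
  many possibilities for its domain and range. In a Hausdorff space every point of a finite open set
  is isolated, so \<open>\<xi>\<close> is.
\<close>

section \<open>Elements with prescribed domain and range\<close>

lemma cofinite_monotone_pmaps_mono:
  "\<lbrakk>\<phi> \<in> cofinite_monotone_pmaps; \<phi> x = Some y; \<phi> x' = Some y'\<rbrakk> \<Longrightarrow> x < x' \<longleftrightarrow> y < y'"
  unfolding cofinite_monotone_pmaps_iff by blast

text \<open>
  If two elements with the same range disagree, consider the least point of disagreement: the smaller
  of the two values there is attained by the other map at an earlier point, where the maps
  agree, and this contradicts monotonicity. The induction step is stated for an ordered pair of maps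
  because both orders are needed.
\<close>

lemma cofinite_monotone_pmaps_eqI:
  assumes \<phi>: "\<phi> \<in> cofinite_monotone_pmaps" and \<psi>: "\<psi> \<in> cofinite_monotone_pmaps"
    and dom: "dom \<phi> = dom \<psi>" and ran: "ran \<phi> = ran \<psi>"
  shows "\<phi> = \<psi>"
proof
  have not_less: "\<not> y < z"
    if \<phi>: "\<phi> \<in> cofinite_monotone_pmaps" and \<psi>: "\<psi> \<in> cofinite_monotone_pmaps"
      and ran: "ran \<phi> = ran \<psi>"
      and IH: "\<And>x'. x' < x \<Longrightarrow> \<phi> x' = \<psi> x'" and y: "\<phi> x = Some y" and z: "\<psi> x = Some z"
    for \<phi> \<psi> x y z
  proof
    assume "y < z"
    obtain x' where x': "\<psi> x' = Some y"
      using y ran by (auto simp: ran_def)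
    then have "x' < x"
      using cofinite_monotone_pmaps_mono[OF \<psi> x' z] \<open>y < z\<close> by simp
    moreover have "\<phi> x' = Some y"
      using IH[OF \<open>x' < x\<close>] x' by simp
    ultimately show False
      using cofinite_monotone_pmaps_mono[OF \<phi> _ y] by blast
  qed
  fix x show "\<phi> x = \<psi> x"
  proof (induction x rule: less_induct)
    case (less x)
    show ?case
    proof (cases "\<phi> x")
      case None
      then show ?thesis using dom by (metis domIff)
    next
      case (Some y)
      then obtain z where z: "\<psi> x = Some z"
        using dom by (metis domD domI)
      have "\<not> y < z" and "\<not> z < y"
        using not_less[OF \<phi> \<psi> ran less Some z] not_less[OF \<psi> \<phi> ran[symmetric] less[symmetric] z Some]
        by blast+
      then show ?thesis using Some z by simp
    qed
  qed
qed

text \<open>The map sending the \<open>n\<close>-th element of \<open>A\<close> to the \<open>n\<close>-th element of \<open>B\<close>.\<close>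

lemma cofinite_monotone_pmaps_exists:
  assumes A: "A \<subseteq> pos_nats" "finite (pos_nats - A)" and B: "B \<subseteq> pos_nats" "finite (pos_nats - B)"
  obtains \<phi> where "\<phi> \<in> cofinite_monotone_pmaps" "dom \<phi> = A" "ran \<phi> = B"
proof -
  have "infinite pos_nats"
    unfolding pos_nats_def using infinite_Ioi[of "0::nat"] by (simp add: greaterThan_def)
  then have "infinite C" if "finite (pos_nats - C)" for C
    using that by (metis finite_Diff2)
  then have inf: "infinite A" "infinite B"
    using A B by blast+
  define i where "i = inv_into UNIV (enumerate A)"
  have bij: "bij_betw i A UNIV"
    unfolding i_def by (intro bij_betw_inv_into bij_enumerate inf)
  have i_mono: "i x < i x' \<longleftrightarrow> x < x'" if "x \<in> A" "x' \<in> A" for x x'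
  proof -
    have "enumerate A (i y) = y" if "y \<in> A" for y
      using that bij_betw_inv_into_right[OF bij_enumerate[OF inf(1)]] by (simp add: i_def)
    then show ?thesis
      using that enumerate_mono_iff[OF inf(1), of "i x" "i x'"] by simp
  qed
  define \<phi> where "\<phi> = (\<lambda>x. if x \<in> A then Some (enumerate B (i x)) else None)"
  have dom: "dom \<phi> = A"
    by (auto simp: \<phi>_def split: if_splits)
  have "ran \<phi> = enumerate B ` i ` A"
    by (auto simp: \<phi>_def ran_def)
  also have "\<dots> = B"
    using bij_betw_imp_surj_on[OF bij] bij_betw_imp_surj_on[OF bij_enumerate[OF inf(2)]] by simp
  finally have ran: "ran \<phi> = B" .
  have "\<phi> \<in> cofinite_monotone_pmaps"
    unfolding cofinite_monotone_pmaps_iff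
  proof (intro conjI allI impI)
    fix x y assume "\<phi> x = Some y"
    then have "x \<in> A" "y \<in> B" using dom ran by (auto simp: ran_def)
    then show "0 < x" "0 < y" using A(1) B(1) by (auto simp: pos_nats_def)
  next
    fix x x' y y' assume "\<phi> x = Some y" "\<phi> x' = Some y'"
    then show "x < x' \<longleftrightarrow> y < y'"
      using i_mono inf(2) by (auto simp: \<phi>_def split: if_splits)
  qed (use A B dom ran in auto)
  then show ?thesis using that dom ran by blast
qed

lemma inj_on_dom_ran: "inj_on (\<lambda>\<phi>. (dom \<phi>, ran \<phi>)) cofinite_monotone_pmaps"
  by (rule inj_onI, rule cofinite_monotone_pmaps_eqI) simp_all

lemma dom_ran_subset_pos_nats:
  assumes "\<phi> \<in> cofinite_monotone_pmaps"
  shows "dom \<phi> \<subseteq> pos_nats" "finite (pos_nats - dom \<phi>)"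
    and "ran \<phi> \<subseteq> pos_nats" "finite (pos_nats - ran \<phi>)"
  using assms by (simp_all add: cofinite_monotone_pmaps_def)

lemma countable_cofinite_monotone_pmaps: "countable cofinite_monotone_pmaps"
proof -
  let ?C = "{A. A \<subseteq> pos_nats \<and> finite (pos_nats - A)}"
  have "?C \<subseteq> (\<lambda>F. pos_nats - F) ` Collect finite"
  proof
    fix A assume "A \<in> ?C"
    then have "A = pos_nats - (pos_nats - A)" "pos_nats - A \<in> Collect finite" by auto
    then show "A \<in> (\<lambda>F. pos_nats - F) ` Collect finite" by (rule image_eqI)
  qed
  then have "countable ?C"
    by (rule countable_subset) (rule countable_image[OF countable_Collect_finite])
  then have "countable (?C \<times> ?C)" by simp
  moreover have "(\<lambda>\<phi>. (dom \<phi>, ran \<phi>)) ` cofinite_monotone_pmaps \<subseteq> ?C \<times> ?C"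
    by (intro image_subsetI SigmaI) (simp_all add: dom_ran_subset_pos_nats)
  ultimately have "countable ((\<lambda>\<phi>. (dom \<phi>, ran \<phi>)) ` cofinite_monotone_pmaps)"
    by (rule countable_subset[rotated])
  then show ?thesis
    using inj_on_dom_ran by (rule countable_image_inj_on)
qed

section \<open>Two-sided translations with finite fibres\<close>

lemma finite_cofinite_supersets:
  assumes "finite (U - A)"
  shows "finite {D. A \<subseteq> D \<and> D \<subseteq> U}"
proof (rule finite_subset)
  show "{D. A \<subseteq> D \<and> D \<subseteq> U} \<subseteq> (\<union>) A ` Pow (U - A)"
  proof
    fix D assume "D \<in> {D. A \<subseteq> D \<and> D \<subseteq> U}"
    then have "D = A \<union> (D - A)" "D - A \<in> Pow (U - A)" by auto
    then show "D \<in> (\<union>) A ` Pow (U - A)" by (rule image_eqI)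
  qed
  show "finite ((\<union>) A ` Pow (U - A))"
    using assms by simp
qed

text \<open>
  Only finitely many points can be added to the cofinite sets \<open>dom \<xi>\<close> and \<open>ran \<xi>\<close>, and the enlarged
  domain and range determine \<open>\<eta>\<close>.
\<close>

lemma finite_dom_ran_supersets:
  assumes "\<xi> \<in> cofinite_monotone_pmaps"
  shows "finite {\<eta> \<in> cofinite_monotone_pmaps. dom \<xi> \<subseteq> dom \<eta> \<and> ran \<xi> \<subseteq> ran \<eta>}" (is "finite ?E")
proof -
  let ?D = "{D. dom \<xi> \<subseteq> D \<and> D \<subseteq> pos_nats}" and ?R = "{R. ran \<xi> \<subseteq> R \<and> R \<subseteq> pos_nats}"
  have "finite (?D \<times> ?R)"
    using dom_ran_subset_pos_nats[OF assms] by (intro finite_cartesian_product finite_cofinite_supersets)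
  moreover have "(\<lambda>\<phi>. (dom \<phi>, ran \<phi>)) ` ?E \<subseteq> ?D \<times> ?R"
    by (intro image_subsetI SigmaI) (simp_all add: dom_ran_subset_pos_nats)
  moreover have "inj_on (\<lambda>\<phi>. (dom \<phi>, ran \<phi>)) ?E"
    by (rule inj_on_subset[OF inj_on_dom_ran]) auto
  ultimately show ?thesis
    by (meson finite_imageD finite_subset)
qed

text \<open>
  With \<open>\<beta>\<close> from \<open>dom \<alpha>\<close> onto \<open>dom \<xi>\<close> and \<open>\<gamma>\<close> from \<open>ran \<xi>\<close> onto \<open>ran \<alpha>\<close>, the product \<open>\<beta>\<xi>\<gamma>\<close> has the
  domain and the range of \<open>\<alpha>\<close>, hence equals \<open>\<alpha>\<close>. If \<open>\<beta>\<eta>\<gamma> = \<alpha>\<close>, then \<open>\<beta>\<eta>\<gamma>\<close> is defined on all of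
  \<open>dom \<beta>\<close>, so \<open>\<eta>\<close> is defined on \<open>ran \<beta> = dom \<xi>\<close>; dually, \<open>\<beta>\<eta>\<gamma>\<close> attains all of \<open>ran \<gamma>\<close>, so \<open>\<eta>\<close> attains
  \<open>dom \<gamma> = ran \<xi>\<close> by injectivity of \<open>\<gamma>\<close>.
\<close>

lemma translation_with_finite_fibre:
  assumes \<alpha>: "\<alpha> \<in> cofinite_monotone_pmaps" and \<xi>: "\<xi> \<in> cofinite_monotone_pmaps"
  obtains \<beta> \<gamma> where "\<beta> \<in> cofinite_monotone_pmaps" "\<gamma> \<in> cofinite_monotone_pmaps"
    and "pmap_mult (pmap_mult \<beta> \<xi>) \<gamma> = \<alpha>"
    and "finite {\<eta> \<in> cofinite_monotone_pmaps. pmap_mult (pmap_mult \<beta> \<eta>) \<gamma> = \<alpha>}"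
proof -
  obtain \<beta> where \<beta>: "\<beta> \<in> cofinite_monotone_pmaps" "dom \<beta> = dom \<alpha>" "ran \<beta> = dom \<xi>"
    using cofinite_monotone_pmaps_exists dom_ran_subset_pos_nats(1,2)[OF \<alpha>]
      dom_ran_subset_pos_nats(1,2)[OF \<xi>] by blast
  obtain \<gamma> where \<gamma>: "\<gamma> \<in> cofinite_monotone_pmaps" "dom \<gamma> = ran \<xi>" "ran \<gamma> = ran \<alpha>"
    using cofinite_monotone_pmaps_exists dom_ran_subset_pos_nats(3,4)[OF \<xi>]
      dom_ran_subset_pos_nats(3,4)[OF \<alpha>] by blast
  let ?t = "\<lambda>\<eta>. pmap_mult (pmap_mult \<beta> \<eta>) \<gamma>"
  have t_iff: "?t \<eta> x = Some z \<longleftrightarrow> (\<exists>u v. \<beta> x = Some u \<and> \<eta> u = Some v \<and> \<gamma> v = Some z)" for \<eta> x z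
    by (auto simp: pmap_mult_eq_Some)
  have ran_SomeD: "\<exists>x. f x = Some y" if "y \<in> ran f" for f :: "nat \<rightharpoonup> nat" and y
    using that by (simp add: ran_def)
  have "?t \<xi> = \<alpha>"
  proof (rule cofinite_monotone_pmaps_eqI)
    show "?t \<xi> \<in> cofinite_monotone_pmaps"
      by (intro pmap_mult_closed \<beta> \<gamma> \<xi>)
    show "dom (?t \<xi>) = dom \<alpha>"
    proof (intro equalityI subsetI)
      fix x assume "x \<in> dom (?t \<xi>)"
      then have "x \<in> dom \<beta>" using t_iff by blast
      then show "x \<in> dom \<alpha>" using \<beta> by simp
    next
      fix x assume "x \<in> dom \<alpha>"
      then obtain u where u: "\<beta> x = Some u" using \<beta> by (metis domD)
      then have "u \<in> dom \<xi>" using \<beta> by (metis ranI)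
      then obtain v where v: "\<xi> u = Some v" by auto
      then have "v \<in> dom \<gamma>" using \<gamma> by (metis ranI)
      then show "x \<in> dom (?t \<xi>)" using u v t_iff by blast
    qed
    show "ran (?t \<xi>) = ran \<alpha>"
    proof (intro equalityI subsetI)
      fix z assume "z \<in> ran (?t \<xi>)"
      then have "z \<in> ran \<gamma>" unfolding ran_def using t_iff by blast
      then show "z \<in> ran \<alpha>" using \<gamma> by simp
    next
      fix z assume "z \<in> ran \<alpha>"
      then obtain v where v: "\<gamma> v = Some z" using \<gamma> by (metis ran_SomeD)
      then have "v \<in> ran \<xi>" using \<gamma> by (metis domI)
      then obtain u where u: "\<xi> u = Some v" by (metis ran_SomeD)
      then have "u \<in> ran \<beta>" using \<beta> by (metis domI)
      then obtain x where "\<beta> x = Some u" by (metis ran_SomeD)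
      then have "?t \<xi> x = Some z" using t_iff u v by blast
      then show "z \<in> ran (?t \<xi>)" by (rule ranI)
    qed
  qed (fact \<alpha>)
  moreover have "dom \<xi> \<subseteq> dom \<eta> \<and> ran \<xi> \<subseteq> ran \<eta>" if \<eta>: "?t \<eta> = \<alpha>" for \<eta>
  proof (intro conjI subsetI)
    fix u assume "u \<in> dom \<xi>"
    then obtain x where x: "\<beta> x = Some u" using \<beta> by (metis ran_SomeD)
    then have "x \<in> dom \<alpha>" using \<beta> by (metis domI)
    then obtain z where "?t \<eta> x = Some z" using \<eta> by (metis domD)
    then show "u \<in> dom \<eta>" using x t_iff by auto
  next
    fix v assume "v \<in> ran \<xi>"
    then obtain z where z: "\<gamma> v = Some z" using \<gamma> by (metis domD)
    then have "z \<in> ran \<alpha>" using \<gamma> by (metis ranI)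
    then obtain x where "?t \<eta> x = Some z" using \<eta> by (metis ran_SomeD)
    then obtain u v' where v': "\<eta> u = Some v'" "\<gamma> v' = Some z" using t_iff by blast
    have "v' = v"
      using inj_onD[OF cofinite_monotone_pmaps_inj_on[OF \<gamma>(1)], of v' v] v' z by auto
    then show "v \<in> ran \<eta>" using v' by (auto intro: ranI)
  qed
  then have "finite {\<eta> \<in> cofinite_monotone_pmaps. ?t \<eta> = \<alpha>}"
    by (intro finite_subset[OF _ finite_dom_ran_supersets[OF \<xi>]]) blast
  ultimately show ?thesis using that \<beta>(1) \<gamma>(1) by blast
qed

section \<open>Isolated points\<close>

lemma countable_locally_compact_Hausdorff_isolated_point:
  assumes lc: "locally_compact_space X" and H: "Hausdorff_space X"
    and count: "countable (topspace X)" and ne: "topspace X \<noteq> {}"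
  obtains x where "x \<in> topspace X" "openin X {x}"
proof -
  have "\<exists>x\<in>topspace X. openin X {x}"
  proof (rule ccontr)
    assume none: "\<not> ?thesis"
    let ?G = "(\<lambda>x. {x}) ` topspace X"
    have "X interior_of \<Union>?G = {}"
    proof (rule Baire_category_alt)
      show "completely_metrizable_space X \<or> locally_compact_space X \<and> regular_space X"
        using lc H locally_compact_Hausdorff_imp_regular_space by blast
      show "countable ?G" using count by simp
      fix T assume "T \<in> ?G"
      then obtain x where x: "x \<in> topspace X" "T = {x}" by blast
      have "X interior_of {x} = {} \<or> X interior_of {x} = {x}"
        using interior_of_subset[of X "{x}"] by blast
      then have "X interior_of T = {}"
        using none x openin_interior_of[of X "{x}"] by metis
      then show "closedin X T \<and> X interior_of T = {}"
        using x closedin_Hausdorff_finite[OF H] by simp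
    qed
    then show False using ne by simp
  qed
  then show ?thesis using that by blast
qed

lemma Hausdorff_finite_open_isolated:
  assumes "Hausdorff_space X" "openin X U" "finite U" "x \<in> U"
  shows "openin X {x}"
proof -
  have "closedin X (U - {x})"
    using assms openin_subset by (intro closedin_Hausdorff_finite) blast+
  then have "openin X (U - (U - {x}))"
    using assms by (intro openin_diff)
  then show ?thesis using assms by (simp add: double_diff)
qed

lemma continuous_two_sided_translation:
  assumes mul: "continuous_map (prod_topology X X) X (\<lambda>(x, y). mul x y)"
    and b: "b \<in> topspace X" and c: "c \<in> topspace X"
  shows "continuous_map X X (\<lambda>x. mul (mul b x) c)"
proof -
  have comp: "continuous_map X X (\<lambda>x. mul (f x) (g x))"
    if "continuous_map X X f" "continuous_map X X g" for f g
    using continuous_map_compose[OF continuous_map_pairedI[OF that] mul] by (simp add: o_def)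
  show ?thesis
    using b c by (intro comp) (simp_all add: continuous_map_id[unfolded id_def])
qed

theorem theorem3p3:
  fixes \<tau> :: "(nat \<rightharpoonup> nat) topology"
  assumes "topspace \<tau> = cofinite_monotone_pmaps"
    and "locally_compact_space \<tau>"
    and "Hausdorff_space \<tau>"
    and "topological_inverse_semigroup \<tau> pmap_mult pmap_inv"
  shows "\<tau> = discrete_topology cofinite_monotone_pmaps"
proof -
  obtain \<phi> where "\<phi> \<in> cofinite_monotone_pmaps"
    by (rule cofinite_monotone_pmaps_exists[of pos_nats pos_nats]) simp_all
  then have "topspace \<tau> \<noteq> {}" and "countable (topspace \<tau>)"
    using assms(1) countable_cofinite_monotone_pmaps by auto
  then obtain \<alpha> where \<alpha>: "\<alpha> \<in> cofinite_monotone_pmaps" "openin \<tau> {\<alpha>}"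
    using countable_locally_compact_Hausdorff_isolated_point[OF assms(2,3)] assms(1) by metis
  have "openin \<tau> {\<xi>}" if \<xi>: "\<xi> \<in> cofinite_monotone_pmaps" for \<xi>
  proof -
    obtain \<beta> \<gamma> where \<beta>\<gamma>: "\<beta> \<in> cofinite_monotone_pmaps" "\<gamma> \<in> cofinite_monotone_pmaps"
      and eq: "pmap_mult (pmap_mult \<beta> \<xi>) \<gamma> = \<alpha>"
      and fin: "finite {\<eta> \<in> cofinite_monotone_pmaps. pmap_mult (pmap_mult \<beta> \<eta>) \<gamma> = \<alpha>}"
      using translation_with_finite_fibre[OF \<alpha>(1) \<xi>] by blast
    have "continuous_map \<tau> \<tau> (\<lambda>\<eta>. pmap_mult (pmap_mult \<beta> \<eta>) \<gamma>)"
      using assms(1,4) \<beta>\<gamma>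
      by (intro continuous_two_sided_translation) (simp_all add: topological_inverse_semigroup_def)
    from openin_continuous_map_preimage[OF this \<alpha>(2)]
    have "openin \<tau> {\<eta> \<in> cofinite_monotone_pmaps. pmap_mult (pmap_mult \<beta> \<eta>) \<gamma> = \<alpha>}"
      using assms(1) by simp
    then show ?thesis
      by (rule Hausdorff_finite_open_isolated[OF assms(3) _ fin]) (use \<xi> eq in simp)
  qed
  then show ?thesis
    using assms(1) discrete_topology_unique[of cofinite_monotone_pmaps \<tau>] by auto
qed

end
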